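(* Let $a > 0$ be a real number. Then the function $x \mapsto a^x$ is continuously differentiable at every $x \in \mathbb{R}$. Moreover, for all $x \in \mathbb{R}$, \[ \frac{d}{dx} a^x = (\ln a)\, a^x . \]
   Context: For real $a > 0$, $a^x$ ($x \in \mathbb{R}$) is the continuous extension to $\mathbb{R}$ of the function $q \mapsto a^q$ defined on $\mathbb{Q}$ (rational powers). Equivalently, $a^x = \sup\{a^q : q \in \mathbb{Q},\ q < x\}$ if $a \ge 1$, and $a^x = \inf\{a^q : q \in \mathbb{Q},\ q < x\}$ if $0 < a < 1$. For every real $a>0$ the function $x \mapsto a^x$ is differentiable at $0$, and $\ln : (0,\infty) \to \mathbb{R}$ is defined by $\ln a = \left.\frac{d}{dx} a^x\right|_{x=0}$, i.e. $\ln a = \lim_{h \to 0} \frac{a^h - 1}{h}$. *)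

theory Defs
  imports "HOL-Analysis.Analysis"
begin

(* The rational power a^(m/n), the positive n-th root of a^m, for q = m/n in lowest terms
   with n > 0. It is only meant for a > 0. *)
definition rat_power :: "real \<Rightarrow> rat \<Rightarrow> real" where
  "rat_power a q = (case quotient_of q of (m, n) \<Rightarrow> root (nat n) (a powi m))"

(* The real power a^x for a > 0: the continuous extension of the rational power to the reals.
   The lemma below shows that the description is well defined. *)
definition real_power :: "real \<Rightarrow> real \<Rightarrow> real" where
  "real_power a = (THE f. continuous_on UNIV f \<and> (\<forall>q. f (of_rat q) = rat_power a q))"

(* ln a is by definition the derivative of a^x at x = 0; it is not the library's ln, which is
   defined as the inverse of exp. *)
definition natural_log :: "real \<Rightarrow> real" where
  "natural_log a = deriv (real_power a) 0"

lemma rat_power_eq_powr: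
  assumes "a > 0"
  shows "rat_power a q = a powr of_rat q"
proof -
  obtain m n where q: "quotient_of q = (m, n)" by (cases "quotient_of q")
  have n: "n > 0" using quotient_of_denom_pos[OF q] .
  have "(of_rat q :: real) = of_int m / of_int n"
    using quotient_of_div[OF q] by (simp add: of_rat_divide)
  moreover have "a powi m = a powr of_int m"
    using assms by (simp add: powr_real_of_int')
  ultimately show ?thesis
    using assms n by (simp add: rat_power_def q root_powr_inverse powr_powr)
qed

lemma ex1_continuous_extension:
  assumes "a > 0"
  shows "\<exists>!f :: real \<Rightarrow> real. continuous_on UNIV f \<and> (\<forall>q. f (of_rat q) = rat_power a q)"
proof (rule ex1I[of _ "\<lambda>x. a powr x"])
  show "continuous_on UNIV (\<lambda>x. a powr x) \<and> (\<forall>q. a powr (of_rat q) = rat_power a q)"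
    using assms by (auto simp: rat_power_eq_powr intro!: continuous_intros)
next
  fix f :: "real \<Rightarrow> real"
  assume f: "continuous_on UNIV f \<and> (\<forall>q. f (of_rat q) = rat_power a q)"
  have "f x - a powr x = 0" for x
  proof (rule continuous_constant_on_closure[where S = "\<rat>" and f = "\<lambda>x. f x - a powr x"])
    show "continuous_on (closure \<rat>) (\<lambda>x. f x - a powr x)"
      using f assms by (auto intro!: continuous_intros intro: continuous_on_subset)
    show "f x - a powr x = 0" if "x \<in> \<rat>" for x
      using that f assms by (auto elim!: Rats_cases simp: rat_power_eq_powr)
    show "x \<in> closure \<rat>"
      by (simp add: Rats_closure_real)
  qed
  then show "f = (\<lambda>x. a powr x)" by (simp add: fun_eq_iff)
qed

end

theory Submission
  imports Defs
begin

text \<open>Since the rationals are dense, rational powers have only one continuous extension, so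
  \<open>real_power a\<close> is \<open>powr\<close> with base \<open>a\<close>
  (\<open>real_power_eq_powr\<close>). Its derivative is the library's \<open>ln a\<close> times
  itself, and at 0 this identifies \<open>natural_log a\<close> with \<open>ln a\<close>. The
  derivative is a constant multiple of a continuous function, hence continuous.\<close>

lemma real_power_eq_powr:
  assumes "a > 0"
  shows "real_power a = (\<lambda>x. a powr x)"
  unfolding real_power_def
  using assms
  by (intro the1_equality ex1_continuous_extension)
     (auto simp: rat_power_eq_powr intro!: continuous_intros)

lemma has_real_derivative_real_power:
  assumes "a > 0"
  shows "(real_power a has_real_derivative ln a * real_power a x) (at x)"
  using assms by (auto simp: real_power_eq_powr intro!: derivative_eq_intros)

text \<open>The derivative at 0 is \<open>ln a * a powr 0\<close>, and \<open>a powr 0 = 1\<close>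
  because \<open>a\<close> is nonzero.\<close>

lemma natural_log_eq_ln:
  assumes "a > 0"
  shows "natural_log a = ln a"
  using DERIV_imp_deriv[OF has_real_derivative_real_power[OF assms, of 0]] assms
  by (simp add: natural_log_def real_power_eq_powr)

theorem theorem3p9:
  fixes a :: real
  assumes "a > 0"
  shows "real_power a C1_differentiable_on UNIV \<and>
    (\<forall>x. (real_power a has_real_derivative natural_log a * real_power a x) (at x))"
proof -
  have deriv: "(real_power a has_real_derivative natural_log a * real_power a x) (at x)" for x
    using has_real_derivative_real_power[OF assms] by (simp add: natural_log_eq_ln[OF assms])
  moreover have "continuous_on UNIV (\<lambda>x. natural_log a * real_power a x)"
    using assms by (auto simp: real_power_eq_powr intro!: continuous_intros)
  ultimately show ?thesis
    \<comment> \<open>\<open>C1_differentiable_on\<close> asks for a continuous vector derivative,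
      hence the conversion.\<close>
    unfolding C1_differentiable_on_def has_real_derivative_iff_has_vector_derivative
    by (intro conjI exI[of _ "\<lambda>x. natural_log a * real_power a x"]) auto
qed

end
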